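(* Let $\varphi_e(z)=e^z$ and $\varphi_S(z)=1+\sin z$ for $z\in\mathbb D$. Then $$R_{\mathcal S^*(\varphi_S)}(\mathcal S^*(\varphi_e))=\log(1+\sin 1).$$
   Context: Let $\mathbb D=\{z\in\mathbb C:|z|<1\}$ and let $\mathcal A$ be the class of functions $f$ analytic on $\mathbb D$ with $f(0)=0$ and $f'(0)=1$. For an analytic function $\varphi$ on $\mathbb D$ with $\varphi(0)=1$, the class $\mathcal S^*(\varphi)$ consists of all $f\in\mathcal A$ with $zf'(z)/f(z)\prec\varphi(z)$; that is, there is an analytic $\omega:\mathbb D\to\mathbb D$ with $\omega(0)=0$ such that $zf'(z)/f(z)=\varphi(\omega(z))$ on $\mathbb D$ (the quotient takes the value $1$ at $z=0$, and $f$ has no other zeros). For two such functions $\varphi_1,\varphi_2$, the sharp $\mathcal S^*(\varphi_2)$-radius of $\mathcal S^*(\varphi_1)$ is $$R_{\mathcal S^*(\varphi_2)}(\mathcal S^*(\varphi_1))=\sup\left\{r\in(0,1]: f_r(z)=\tfrac{f(rz)}{r}\text{ belongs to }\mathcal S^*(\varphi_2)\text{ for every } f\in\mathcal S^*(\varphi_1)\right\}.$$ *)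

theory Defs
  imports "HOL-Complex_Analysis.Complex_Analysis"
begin

abbreviation unit_disc :: "complex set"
  where "unit_disc \<equiv> ball 0 1"

text \<open>
  Functions on the unit disc are represented by total functions on the complex plane.
  All definitions below depend only on their values in the disc.
\<close>

definition normalized_analytic :: "(complex \<Rightarrow> complex) set"
  where "normalized_analytic = {f. f holomorphic_on unit_disc \<and> f 0 = 0 \<and> deriv f 0 = 1}"

definition subordinate :: "(complex \<Rightarrow> complex) \<Rightarrow> (complex \<Rightarrow> complex) \<Rightarrow> bool"
  where "subordinate g h \<longleftrightarrow>
    (\<exists>\<omega>. \<omega> holomorphic_on unit_disc \<and> \<omega> ` unit_disc \<subseteq> unit_disc \<and> \<omega> 0 = 0 \<and>
         (\<forall>z\<in>unit_disc. g z = h (\<omega> z)))"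

text \<open>The value at \<open>0\<close> is the one obtained by removing the singularity when \<open>f 0 = 0\<close> and \<open>f' 0 = 1\<close>.\<close>

definition starlike_quotient :: "(complex \<Rightarrow> complex) \<Rightarrow> complex \<Rightarrow> complex"
  where "starlike_quotient f z = (if z = 0 then 1 else z * deriv f z / f z)"

text \<open>
  This is the Ma--Minda type class, meant for \<open>\<phi>\<close> holomorphic on the disc with \<open>\<phi> 0 = 1\<close>.
  Since division by zero yields \<open>0\<close>, the absence of further zeros of \<open>f\<close> has to be required explicitly.
\<close>

definition starlike_class :: "(complex \<Rightarrow> complex) \<Rightarrow> (complex \<Rightarrow> complex) set"
  where "starlike_class \<phi> =
    {f \<in> normalized_analytic.
       (\<forall>z\<in>unit_disc - {0}. f z \<noteq> 0) \<and> subordinate (starlike_quotient f) \<phi>}"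

definition dilation :: "real \<Rightarrow> (complex \<Rightarrow> complex) \<Rightarrow> complex \<Rightarrow> complex"
  where "dilation r f = (\<lambda>z. f (of_real r * z) / of_real r)"

text \<open>The target class comes first, as in the notation \<open>R\<^bsub>S(\<phi>\<^sub>2)\<^esub>(S(\<phi>\<^sub>1))\<close>.\<close>

definition starlike_radius :: "(complex \<Rightarrow> complex) \<Rightarrow> (complex \<Rightarrow> complex) \<Rightarrow> real"
  where "starlike_radius \<phi>\<^sub>2 \<phi>\<^sub>1 =
    Sup {r \<in> {0<..1}. \<forall>f\<in>starlike_class \<phi>\<^sub>1. dilation r f \<in> starlike_class \<phi>\<^sub>2}"

end

theory Submission
  imports Defs
begin

text \<open>
  For membership in the target class one needs that \<open>\<lambda>w. Arcsin (exp w - 1)\<close> maps the disc of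
  radius \<open>ln (1 + sin 1)\<close> into the unit disc.  This splits into
  \<open>\<bar>exp w - 1\<bar> \<le> exp \<bar>w\<bar> - 1 < sin 1\<close> and the fact that the principal arcsine maps the disc of
  radius \<open>sin 1\<close> into the unit disc.  The latter comes from
  \<open>\<bar>sin (a + \<i> b)\<bar>\<^sup>2 = sin\<^sup>2 a + sinh\<^sup>2 b \<ge> sin\<^sup>2 a + b\<^sup>2\<close> and, for \<open>a\<^sup>2 + b\<^sup>2 \<ge> 1\<close>, from
  \<open>sin\<^sup>2 1 - sin\<^sup>2 s = sin (1 + s) sin (1 - s) \<le> 1 - s\<^sup>2\<close>.
  Sharpness is seen on the positive real axis for the function \<open>f\<close> with \<open>z f'(z) / f(z) = exp z\<close>,
  because a real value of the sine on the unit disc is smaller than \<open>sin 1\<close>.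
\<close>

section \<open>Estimates for the exponential and the sine\<close>

text \<open>Termwise triangle inequality in the exponential series stripped of its constant
  term.\<close>

lemma norm_exp_minus_one_le:
  fixes z :: complex
  shows "norm (exp z - 1) \<le> exp (norm z) - 1"
proof -
  have s: "(\<lambda>n. x ^ Suc n /\<^sub>R fact (Suc n)) sums (exp x - 1)"
    for x :: "'a::{real_normed_algebra_1,banach}"
    using exp_converges[of x] by (subst sums_Suc_iff) simp
  have "norm (exp z - 1) \<le> (\<Sum>n. norm z ^ Suc n /\<^sub>R fact (Suc n))"
    unfolding sums_unique[OF s[of z]]
    by (rule norm_suminf_le)
       (use s[of "norm z"] in \<open>auto simp: norm_mult norm_power sums_iff simp del: fact_Suc\<close>)
  also have "\<dots> = exp (norm z) - 1"
    using s[of "norm z"] by (simp add: sums_iff)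
  finally show ?thesis .
qed

lemma norm_sin_squared_sinh: "(norm (sin z))\<^sup>2 = (sin (Re z))\<^sup>2 + (sinh (Im z))\<^sup>2"
proof -
  have "(norm (sin z))\<^sup>2 = (cosh (2 * Im z) - cos (2 * Re z)) / 2"
    by (simp add: norm_sin_squared cosh_field_def exp_minus field_simps)
  also have "\<dots> = (sin (Re z))\<^sup>2 + (sinh (Im z))\<^sup>2"
    by (simp add: cosh_double cos_double_sin cosh_square_eq)
  finally show ?thesis .
qed

lemma sin_squared_diff_le:
  fixes s t :: real
  assumes "0 \<le> s" "s \<le> t"
  shows "(sin t)\<^sup>2 - (sin s)\<^sup>2 \<le> t\<^sup>2 - s\<^sup>2"
proof -
  have "(sin t)\<^sup>2 - (sin s)\<^sup>2 = sin (t + s) * sin (t - s)"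
    by (simp add: sin_add sin_diff cos_squared_eq algebra_simps flip: power2_eq_square)
  also have "\<dots> \<le> \<bar>sin (t + s)\<bar> * \<bar>sin (t - s)\<bar>"
    by (metis abs_ge_self abs_mult)
  also have "\<dots> \<le> \<bar>t + s\<bar> * \<bar>t - s\<bar>"
    by (intro mult_mono abs_sin_x_le_abs_x) auto
  also have "\<dots> = t\<^sup>2 - s\<^sup>2"
    using assms by (simp add: power2_eq_square algebra_simps)
  finally show ?thesis .
qed

text \<open>The strip condition excludes further zeros of the sine such as \<open>pi\<close>; it is
  what the principal arcsine supplies.\<close>

lemma sin_one_le_norm_sin:
  assumes re: "\<bar>Re z\<bar> \<le> pi / 2" and z: "1 \<le> norm z"
  shows "sin 1 \<le> norm (sin z)"
proof -
  \<comment> \<open>Truncation merges two cases: if \<open>\<bar>Re z\<bar> \<ge> 1\<close>, then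
    \<open>s = 1\<close> and the real part alone suffices; otherwise
    \<open>s = \<bar>Re z\<bar>\<close> and the deficit from \<open>1\<close> is covered by the
    imaginary part.\<close>
  define s where "s = min 1 \<bar>Re z\<bar>"
  have s: "0 \<le> s" "s \<le> 1" "s \<le> \<bar>Re z\<bar>" by (auto simp: s_def)
  have "sin s \<le> sin \<bar>Re z\<bar>"
    using s re by (intro sin_monotone_2pi_le) auto
  moreover have "0 \<le> sin s"
    using s pi_gt3 by (intro sin_ge_zero) auto
  ultimately have "(sin s)\<^sup>2 \<le> (sin \<bar>Re z\<bar>)\<^sup>2"
    by (rule power_mono)
  then have 1: "(sin s)\<^sup>2 \<le> (sin (Re z))\<^sup>2"
    by (simp add: abs_if split: if_splits)
  have "1 \<le> (norm z)\<^sup>2" using z by simp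
  then have 2: "1 - s\<^sup>2 \<le> (Im z)\<^sup>2"
    by (auto simp: s_def min_def cmod_power2)
  have "\<bar>Im z\<bar> \<le> \<bar>sinh (Im z)\<bar>"
    using real_le_abs_sinh[of "Im z"] by (simp add: sinh_field_def exp_minus)
  then have 3: "(Im z)\<^sup>2 \<le> (sinh (Im z))\<^sup>2"
    by (simp add: abs_le_square_iff)
  have "(sin 1)\<^sup>2 \<le> (norm (sin z))\<^sup>2"
    unfolding norm_sin_squared_sinh using 1 2 3 sin_squared_diff_le[OF s(1,2)] by simp
  then show ?thesis by (rule power2_le_imp_le) simp
qed

section \<open>The principal arcsine\<close>

text \<open>\<open>cos (Arcsin z)\<close> is a principal square root, so its real part is
  nonnegative; that real part has the sign of \<open>cos (Re (Arcsin z))\<close>, which is negative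
  beyond \<open>pi / 2\<close>.\<close>

lemma abs_Re_Arcsin_le: "\<bar>Re (Arcsin z)\<bar> \<le> pi / 2"
proof (rule ccontr)
  assume "\<not> ?thesis"
  then have "cos \<bar>Re (Arcsin z)\<bar> < 0"
    using Re_Arcsin_bound[of z] cos_monotone_0_pi[of "pi/2" "\<bar>Re (Arcsin z)\<bar>"] by simp
  then have "Re (cos (Arcsin z)) < 0"
    by (simp add: Re_cos mult_less_0_iff add_pos_pos abs_if split: if_splits)
  moreover have "cos (Arcsin z) = csqrt (1 - z\<^sup>2)"
  proof -
    have "exp (\<i> * Arcsin z) = \<i> * z + csqrt (1 - z\<^sup>2)"
      by (simp add: Arcsin_def Arcsin_body_lemma algebra_simps)
    then show ?thesis
      using exp_Euler[of "Arcsin z"] by simp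
  qed
  ultimately show False using csqrt_principal[of "1 - z\<^sup>2"] by auto
qed

lemma norm_Arcsin_less_one:
  assumes "norm z < sin 1"
  shows "norm (Arcsin z) < 1"
  using sin_one_le_norm_sin[OF abs_Re_Arcsin_le, of z] assms by force

text \<open>As \<open>cos (Re w)\<close> is positive, a vanishing imaginary part of
  \<open>sin w\<close> makes \<open>w\<close> real, and the real sine increases up to
  \<open>1\<close>.\<close>

lemma real_sin_less_sin_one:
  fixes w :: complex
  assumes w: "norm w < 1" and eq: "sin w = of_real x"
  shows "x < sin 1"
proof -
  have re: "\<bar>Re w\<bar> < 1" using abs_Re_le_cmod[of w] w by simp
  then have "cos (Re w) > 0"
    using pi_gt3 by (intro cos_gt_zero_pi) auto
  moreover have "cos (Re w) * (exp (Im w) - exp (- Im w)) = 0"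
    using arg_cong[OF eq, of Im] by (simp add: Im_sin)
  ultimately have "Im w = 0" by simp
  then have "x = sin (Re w)"
    using arg_cong[OF eq, of Re] by (simp add: Re_sin)
  also have "\<dots> < sin 1"
    using re pi_gt3 by (intro sin_monotone_2pi) auto
  finally show ?thesis .
qed

section \<open>Dilations\<close>

lemma has_field_derivative_dilation:
  assumes f: "f holomorphic_on unit_disc" and r: "0 < r" "r \<le> 1" and z: "z \<in> unit_disc"
  shows "(dilation r f has_field_derivative deriv f (of_real r * z)) (at z)"
proof -
  have "of_real r * z \<in> unit_disc"
    using z r mult_left_le_one_le[of "norm z" r] by (auto simp: norm_mult)
  then have "(f has_field_derivative deriv f (of_real r * z)) (at (of_real r * z))"
    using f by (auto intro: holomorphic_derivI)
  then have "((\<lambda>z. f (of_real r * z) / of_real r) has_field_derivative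
      (deriv f (of_real r * z) * of_real r) / of_real r) (at z)"
    by (intro DERIV_cdivide DERIV_chain2[of f]) (auto intro!: derivative_eq_intros)
  then show ?thesis using r by (simp add: dilation_def)
qed

lemma starlike_quotient_dilation:
  assumes "f holomorphic_on unit_disc" "0 < r" "r \<le> 1" "z \<in> unit_disc"
  shows "starlike_quotient (dilation r f) z = starlike_quotient f (of_real r * z)"
  using assms DERIV_imp_deriv[OF has_field_derivative_dilation[OF assms]]
  by (simp add: starlike_quotient_def dilation_def)

lemma dilation_normalized_analytic:
  assumes f: "f \<in> normalized_analytic" and r: "0 < r" "r \<le> 1"
  shows "dilation r f \<in> normalized_analytic"
proof -
  have hol: "f holomorphic_on unit_disc" and f0: "f 0 = 0" "deriv f 0 = 1"
    using f by (auto simp: normalized_analytic_def)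
  note d = has_field_derivative_dilation[OF hol r]
  have "dilation r f holomorphic_on unit_disc"
    using d by (subst holomorphic_on_open) blast+
  moreover have "deriv (dilation r f) 0 = 1"
    using DERIV_imp_deriv[OF d[of 0]] f0 by simp
  ultimately show ?thesis
    using f0 by (simp add: normalized_analytic_def dilation_def)
qed

section \<open>The extremal function and the two bounds\<close>

text \<open>The logarithmic derivative of \<open>f z / z\<close> has to be
  \<open>(exp z - 1) / z\<close>, so \<open>f\<close> is \<open>z\<close> times the exponential of a
  primitive of it.\<close>

lemma exists_starlike_quotient_exp:
  obtains f where "f \<in> starlike_class exp" "\<And>z. z \<in> unit_disc \<Longrightarrow> starlike_quotient f z = exp z"
proof -
  define h :: "complex \<Rightarrow> complex" where "h z = (if z = 0 then 1 else (exp z - 1) / z)" for z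
  have de: "deriv (\<lambda>z. exp z - 1) (0::complex) = 1"
    by (rule DERIV_imp_deriv) (auto intro!: derivative_eq_intros)
  \<comment> \<open>The difference quotient of \<open>exp z - 1\<close> at \<open>0\<close>, whose
    singularity is removable.\<close>
  have "(\<lambda>z. if z = 0 then deriv (\<lambda>z. exp z - 1) 0
              else ((exp z - 1) - (exp 0 - 1)) / (z - 0)) holomorphic_on unit_disc"
    by (rule pole_lemma) (auto intro!: holomorphic_intros)
  then have "h holomorphic_on unit_disc"
    unfolding h_def [abs_def] de by (simp cong: if_cong)
  then obtain G where G: "\<And>z. z \<in> unit_disc \<Longrightarrow> (G has_field_derivative h z) (at z within unit_disc)"
    using holomorphic_convex_primitive'[of unit_disc h] by auto
  then have G: "(G has_field_derivative h z) (at z)" if "z \<in> unit_disc" for z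
    using that by (metis at_within_open open_ball)
  \<comment> \<open>Subtracting \<open>G 0\<close> normalizes the derivative at \<open>0\<close> to
    \<open>1\<close>.\<close>
  define f where "f z = z * exp (G z - G 0)" for z
  have d: "(f has_field_derivative exp z * exp (G z - G 0)) (at z)" if "z \<in> unit_disc" for z
  proof -
    have "(f has_field_derivative exp (G z - G 0) + h z * exp (G z - G 0) * z) (at z)"
      unfolding f_def [abs_def] using G[OF that] by (auto intro!: derivative_eq_intros)
    moreover have "exp (G z - G 0) + h z * exp (G z - G 0) * z = exp z * exp (G z - G 0)"
      by (simp add: h_def field_simps)
    ultimately show ?thesis by simp
  qed
  have q: "starlike_quotient f z = exp z" if "z \<in> unit_disc" for z
    using DERIV_imp_deriv[OF d[OF that]] by (simp add: starlike_quotient_def f_def)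
  have "f holomorphic_on unit_disc"
    using d by (subst holomorphic_on_open) blast+
  then have "f \<in> normalized_analytic"
    using DERIV_imp_deriv[OF d[of 0]] by (simp add: normalized_analytic_def f_def)
  moreover have "subordinate (starlike_quotient f) exp"
    unfolding subordinate_def using q by (intro exI[of _ "\<lambda>z. z"]) (auto intro!: holomorphic_intros)
  ultimately have "f \<in> starlike_class exp"
    by (auto simp: starlike_class_def f_def)
  then show ?thesis using q that by blast
qed

lemma dilation_starlike_class_sin:
  assumes f: "f \<in> starlike_class exp" and r: "0 < r" "r \<le> 1" "r \<le> ln (1 + sin 1)"
  shows "dilation r f \<in> starlike_class (\<lambda>z. 1 + sin z)"
proof -
  have s1: "0 < sin (1::real)" "sin (1::real) < 1"
    using pi_gt3 sin_monotone_2pi[of 1 "pi/2"] by (auto intro: sin_gt_zero)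
  have fn: "f \<in> normalized_analytic" and hol: "f holomorphic_on unit_disc"
    and nz: "\<And>z. z \<in> unit_disc - {0} \<Longrightarrow> f z \<noteq> 0"
    using f by (auto simp: starlike_class_def normalized_analytic_def)
  obtain \<omega> where \<omega>: "\<omega> holomorphic_on unit_disc" "\<omega> ` unit_disc \<subseteq> unit_disc" "\<omega> 0 = 0"
      and q: "\<And>z. z \<in> unit_disc \<Longrightarrow> starlike_quotient f z = exp (\<omega> z)"
    using f by (auto simp: starlike_class_def subordinate_def)
  have scaled: "of_real r * z \<in> unit_disc" if "z \<in> unit_disc" for z
    using that r mult_left_le_one_le[of "norm z" r] by (auto simp: norm_mult)
  \<comment> \<open>The equation \<open>1 + sin w = exp (\<omega> (of_real r * z))\<close> is solved
    by \<open>w = Arcsin (\<eta> z)\<close>, the Schwarz function sought.\<close>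
  define \<eta> where "\<eta> z = exp (\<omega> (of_real r * z)) - 1" for z
  have small: "norm (\<eta> z) < sin 1" if z: "z \<in> unit_disc" for z
  proof -
    \<comment> \<open>The Schwarz lemma bounds the argument of \<open>exp\<close> strictly below
      \<open>r\<close>, so the endpoint \<open>r = ln (1 + sin 1)\<close> is allowed.\<close>
    have "norm (\<omega> (of_real r * z)) \<le> norm (of_real r * z)"
      using \<omega> scaled[OF z] by (intro Schwarz_Lemma) (auto simp: image_subset_iff)
    also have "\<dots> < r" using z r by (simp add: norm_mult)
    finally have "exp (norm (\<omega> (of_real r * z))) < exp (ln (1 + sin 1))"
      using r by simp
    then show ?thesis
      using norm_exp_minus_one_le[of "\<omega> (of_real r * z)"] s1 by (simp add: \<eta>_def)
  qed
  have "(\<omega> \<circ> (\<lambda>z. of_real r * z)) holomorphic_on unit_disc"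
    using scaled by (intro holomorphic_on_compose_gen[OF _ \<omega>(1)]) (auto intro!: holomorphic_intros)
  then have "\<eta> holomorphic_on unit_disc"
    unfolding \<eta>_def [abs_def] by (auto intro!: holomorphic_intros simp: o_def)
  \<comment> \<open>Since \<open>sin 1 < 1\<close>, the values of \<open>\<eta>\<close> stay off the
    branch cuts.\<close>
  moreover have "Arcsin holomorphic_on \<eta> ` unit_disc"
  proof (rule holomorphic_on_Arcsin)
    fix u assume "u \<in> \<eta> ` unit_disc"
    then have "norm u < 1" using small s1 by force
    then show "\<bar>Re u\<bar> < 1" using abs_Re_le_cmod[of u] by simp
  qed
  ultimately have "(\<lambda>z. Arcsin (\<eta> z)) holomorphic_on unit_disc"
    using holomorphic_on_compose[of \<eta> unit_disc Arcsin] by (simp add: o_def)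
  moreover have "Arcsin (\<eta> 0) = 0" by (simp add: \<eta>_def \<omega>)
  moreover have "(\<lambda>z. Arcsin (\<eta> z)) ` unit_disc \<subseteq> unit_disc"
    using norm_Arcsin_less_one[OF small] by auto
  moreover have "starlike_quotient (dilation r f) z = 1 + sin (Arcsin (\<eta> z))" if "z \<in> unit_disc" for z
    using starlike_quotient_dilation[OF hol r(1,2) that] q[OF scaled[OF that]] by (simp add: \<eta>_def)
  ultimately have "subordinate (starlike_quotient (dilation r f)) (\<lambda>z. 1 + sin z)"
    unfolding subordinate_def by (intro exI[of _ "\<lambda>z. Arcsin (\<eta> z)"]) auto
  moreover have "dilation r f z \<noteq> 0" if "z \<in> unit_disc - {0}" for z
    using nz[of "of_real r * z"] scaled[of z] that r by (auto simp: dilation_def)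
  ultimately show ?thesis
    using dilation_normalized_analytic[OF fn r(1,2)] by (auto simp: starlike_class_def)
qed

lemma radius_le_of_dilations_starlike_sin:
  assumes r: "0 < r" "r \<le> 1"
    and dil: "\<And>f. f \<in> starlike_class exp \<Longrightarrow> dilation r f \<in> starlike_class (\<lambda>z. 1 + sin z)"
  shows "r \<le> ln (1 + sin 1)"
proof (rule ccontr)
  assume "\<not> ?thesis"
  then have less: "ln (1 + sin 1) < r" by simp
  have s1: "0 < sin (1::real)"
    using pi_gt3 by (auto intro: sin_gt_zero)
  obtain f where f: "f \<in> starlike_class exp"
    and q: "\<And>z. z \<in> unit_disc \<Longrightarrow> starlike_quotient f z = exp z"
    using exists_starlike_quotient_exp by blast
  have hol: "f holomorphic_on unit_disc"
    using f by (auto simp: starlike_class_def normalized_analytic_def)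
  \<comment> \<open>At this point of the disc the quotient of the dilated extremal function is
    exactly \<open>1 + sin 1\<close>, a value that \<open>1 + sin w\<close> omits on the open
    disc.\<close>
  define x where "x = ln (1 + sin 1) / r"
  have x: "0 < x" "x < 1" "r * x = ln (1 + sin 1)"
    using s1 r less by (auto simp: x_def divide_simps)
  have xd: "of_real x \<in> unit_disc" using x by simp
  have "0 < r * x" "r * x < 1"
    using x less r s1 by auto
  then have rx: "of_real r * of_real x \<in> unit_disc"
    by (simp flip: of_real_mult)
  obtain \<omega> where \<omega>: "\<omega> ` unit_disc \<subseteq> unit_disc"
      and qd: "\<And>z. z \<in> unit_disc \<Longrightarrow> starlike_quotient (dilation r f) z = 1 + sin (\<omega> z)"
    using dil[OF f] by (auto simp: starlike_class_def subordinate_def)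
  have "1 + sin (\<omega> (of_real x)) = exp (of_real r * of_real x)"
    using qd[OF xd] q[OF rx] starlike_quotient_dilation[OF hol r xd] by simp
  also have "\<dots> = of_real (exp (r * x))"
    by (simp flip: exp_of_real)
  also have "exp (r * x) = 1 + sin 1"
    unfolding x(3) using s1 by (simp add: add_pos_pos)
  finally have "sin (\<omega> (of_real x)) = of_real (sin 1)" by (simp flip: sin_of_real)
  moreover have "norm (\<omega> (of_real x)) < 1" using \<omega> xd by (auto simp: image_subset_iff)
  ultimately show False using real_sin_less_sin_one by blast
qed

theorem theorem7p3:
  shows "starlike_radius (\<lambda>z. 1 + sin z) (\<lambda>z. exp z) = ln (1 + sin (1::real))"
proof -
  have s1: "0 < sin (1::real)"
    using pi_gt3 by (auto intro: sin_gt_zero)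
  then have pos: "0 < ln (1 + sin (1::real))" by simp
  \<comment> \<open>The candidate must lie in \<open>{0<..1}\<close> for the supremum to be attained
    there.\<close>
  have "ln (1 + sin (1::real)) \<le> sin 1"
    using s1 by (intro ln_add_one_self_le_self) simp
  then have le1: "ln (1 + sin (1::real)) \<le> 1"
    using sin_le_one[of 1] by linarith
  show ?thesis
    unfolding starlike_radius_def
  proof (rule cSup_eq_maximum)
    show "ln (1 + sin 1) \<in> {r \<in> {0<..1}. \<forall>f\<in>starlike_class exp.
        dilation r f \<in> starlike_class (\<lambda>z. 1 + sin z)}"
      using pos le1 by (auto intro: dilation_starlike_class_sin)
  next
    fix r assume "r \<in> {r \<in> {0<..1}. \<forall>f\<in>starlike_class exp.
        dilation r f \<in> starlike_class (\<lambda>z. 1 + sin z)}"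
    then show "r \<le> ln (1 + sin 1)"
      by (auto intro: radius_le_of_dilations_starlike_sin)
  qed
qed

end
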